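(* Let $\mathcal{H}$ be a separable complex Hilbert space and let $\Psi=(\psi_n)_{n\in\Gamma}$ be a frame for $\mathcal{H}$. Let $\mathbf{m}=(m_n)_{n\in\Gamma}$ be a positive, semi-normalized sequence. Then the multiplier $\mathbf{M}_{\mathbf{m},\Psi}$ is the frame operator of the frame $(\sqrt{m_n}\,\psi_n)_{n\in\Gamma}$ (in particular this sequence is a frame), and therefore it is positive, self-adjoint and invertible. If instead $(m_n)$ is negative (i.e. $m_n<0$ for all $n$) and semi-normalized, then $\mathbf{M}_{\mathbf{m},\Psi}$ is negative, self-adjoint and invertible.
   Context: The inner product $\langle\cdot,\cdot\rangle$ is linear in the first coordinate. $\Gamma$ is a countable index set. A sequence $(\psi_n)_{n\in\Gamma}$ in $\mathcal{H}$ is a frame if there are constants $m>0$, $M<\infty$ with $m\|f\|^2 \le \sum_{n} |\langle f,\psi_n\rangle|^2 \le M\|f\|^2$ for all $f\in\mathcal{H}$. Its frame operator is $f\mapsto\sum_n\langle f,\psi_n\rangle\psi_n$. A sequence $(c_n)$ of scalars is semi-normalized if there are constants $b\ge a>0$ with $a\le|c_n|\le b$ for all $n$; it is positive if $c_n>0$ for all $n$. For a scalar sequence $\mathbf{m}=(m_n)$, the multiplier is $\mathbf{M}_{\mathbf{m},\Psi}f=\sum_{n} m_n\langle f,\psi_n\rangle\psi_n$. A bounded operator $T$ is positive if $\langle Tf,f\rangle>0$ for all $f\ne0$, and negative if $-T$ is positive. Invertible means having a bounded inverse. *)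

theory Defs
  imports "HOL-Analysis.Analysis"
begin

class complex_vector = real_vector +
  fixes scaleC :: "complex \<Rightarrow> 'a \<Rightarrow> 'a"  (infixr "*\<^sub>C" 75)
  assumes scaleC_add_right: "c *\<^sub>C (x + y) = c *\<^sub>C x + c *\<^sub>C y"
    and scaleC_add_left: "(c + d) *\<^sub>C x = c *\<^sub>C x + d *\<^sub>C x"
    and scaleC_scaleC: "c *\<^sub>C d *\<^sub>C x = (c * d) *\<^sub>C x"
    and scaleC_one: "1 *\<^sub>C x = x"
    and scaleR_scaleC: "r *\<^sub>R x = complex_of_real r *\<^sub>C x"

(* The inner product is linear in the first argument.  The relation 0 <= z on complex
   numbers is the one of HOL-Library.Complex_Order: z is real and nonnegative. *)
class complex_inner = complex_vector + real_normed_vector +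
  fixes cinner :: "'a \<Rightarrow> 'a \<Rightarrow> complex"
  assumes cinner_commute: "cinner x y = cnj (cinner y x)"
    and cinner_add_left: "cinner (x + y) z = cinner x z + cinner y z"
    and cinner_scaleC_left: "cinner (c *\<^sub>C x) y = c * cinner x y"
    and cinner_ge_zero: "0 \<le> cinner x x"
    and cinner_eq_zero_iff: "cinner x x = 0 \<longleftrightarrow> x = 0"
    and norm_eq_sqrt_cinner: "norm x = sqrt (Re (cinner x x))"

class complex_hilbert_space = complex_inner + complete_space

instantiation complex :: complex_hilbert_space
begin

definition scaleC_complex :: "complex \<Rightarrow> complex \<Rightarrow> complex"
  where "scaleC_complex c z = c * z"

definition cinner_complex :: "complex \<Rightarrow> complex \<Rightarrow> complex"
  where "cinner_complex w z = w * cnj z"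

instance
proof
  fix w :: complex
  show "0 \<le> cinner w w"
    by (simp add: cinner_complex_def less_eq_complex_def complex_mult_cnj)
  show "norm w = sqrt (Re (cinner w w))"
    by (simp add: cinner_complex_def cmod_def power2_eq_square)
qed (auto simp: scaleC_complex_def cinner_complex_def algebra_simps scaleR_conv_of_real)

end

definition bounded_operator :: "('a::complex_inner \<Rightarrow> 'a) \<Rightarrow> bool"
  where "bounded_operator T \<longleftrightarrow>
    bounded_linear T \<and> (\<forall>c f. T (c *\<^sub>C f) = c *\<^sub>C T f)"

definition positive_operator :: "('a::complex_inner \<Rightarrow> 'a) \<Rightarrow> bool"
  where "positive_operator T \<longleftrightarrow>
    bounded_operator T \<and> (\<forall>f. f \<noteq> 0 \<longrightarrow> 0 < cinner (T f) f)"

definition negative_operator :: "('a::complex_inner \<Rightarrow> 'a) \<Rightarrow> bool"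
  where "negative_operator T \<longleftrightarrow> positive_operator (\<lambda>f. - T f)"

definition self_adjoint_operator :: "('a::complex_inner \<Rightarrow> 'a) \<Rightarrow> bool"
  where "self_adjoint_operator T \<longleftrightarrow>
    bounded_operator T \<and> (\<forall>f g. cinner (T f) g = cinner f (T g))"

definition invertible_operator :: "('a::complex_inner \<Rightarrow> 'a) \<Rightarrow> bool"
  where "invertible_operator T \<longleftrightarrow>
    bounded_operator T \<and> (\<exists>S. bounded_operator S \<and> S \<circ> T = id \<and> T \<circ> S = id)"

(* Infinite sums over the index set are unconditional (limits over finite subsets).  Since
   infsum is 0 for a divergent sum, finiteness of the middle sum is required separately. *)
definition is_frame :: "'i set \<Rightarrow> ('i \<Rightarrow> 'a::complex_inner) \<Rightarrow> bool"
  where "is_frame \<Gamma> \<psi> \<longleftrightarrow>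
    (\<exists>A B :: real. 0 < A \<and>
      (\<forall>f. (\<lambda>n. (cmod (cinner f (\<psi> n)))\<^sup>2) summable_on \<Gamma> \<and>
           A * (norm f)\<^sup>2 \<le> (\<Sum>\<^sub>\<infinity>n\<in>\<Gamma>. (cmod (cinner f (\<psi> n)))\<^sup>2) \<and>
           (\<Sum>\<^sub>\<infinity>n\<in>\<Gamma>. (cmod (cinner f (\<psi> n)))\<^sup>2) \<le> B * (norm f)\<^sup>2))"

definition frame_operator :: "'i set \<Rightarrow> ('i \<Rightarrow> 'a::complex_inner) \<Rightarrow> 'a \<Rightarrow> 'a"
  where "frame_operator \<Gamma> \<psi> f = (\<Sum>\<^sub>\<infinity>n\<in>\<Gamma>. cinner f (\<psi> n) *\<^sub>C \<psi> n)"

definition multiplier :: "'i set \<Rightarrow> ('i \<Rightarrow> complex) \<Rightarrow> ('i \<Rightarrow> 'a::complex_inner) \<Rightarrow> 'a \<Rightarrow> 'a"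
  where "multiplier \<Gamma> m \<psi> f = (\<Sum>\<^sub>\<infinity>n\<in>\<Gamma>. (m n * cinner f (\<psi> n)) *\<^sub>C \<psi> n)"

definition semi_normalized :: "'i set \<Rightarrow> ('i \<Rightarrow> complex) \<Rightarrow> bool"
  where "semi_normalized \<Gamma> c \<longleftrightarrow>
    (\<exists>a b :: real. 0 < a \<and> a \<le> b \<and> (\<forall>n\<in>\<Gamma>. a \<le> cmod (c n) \<and> cmod (c n) \<le> b))"

end

theory Submission
  imports Defs
begin

text \<open>
  A positive weight can be absorbed into the frame: since
  \<open>m\<^sub>n \<langle>f, \<psi>\<^sub>n\<rangle> \<psi>\<^sub>n = \<langle>f, \<surd>m\<^sub>n \<psi>\<^sub>n\<rangle> \<surd>m\<^sub>n \<psi>\<^sub>n\<close>, the multiplier is, term by term, the frame operator of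
  the weighted family, and \<open>\<bar>\<langle>f, \<surd>m\<^sub>n \<psi>\<^sub>n\<rangle>\<bar>\<^sup>2 = m\<^sub>n \<bar>\<langle>f, \<psi>\<^sub>n\<rangle>\<bar>\<^sup>2\<close> lies between constant multiples of
  \<open>\<bar>\<langle>f, \<psi>\<^sub>n\<rangle>\<bar>\<^sup>2\<close>, so the weighted family is again a frame (\<open>is_frame_csqrt_weights\<close>).
  What remains are the classical properties of the frame operator \<open>S\<close> of an arbitrary frame.

  The upper frame bound says that analysis \<open>f \<mapsto> \<langle>f, \<psi>\<^sub>n\<rangle>\<close> is bounded into \<open>\<ell>\<^sup>2\<close>; by duality so is
  synthesis on finite sums (\<open>synthesis_bound\<close>), and completeness upgrades this to unconditional
  convergence of the series for \<open>S f\<close>, together with a bound on \<open>S\<close>. Pairing the series with \<open>g\<close>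
  gives \<open>\<langle>S f, g\<rangle> = \<Sum> \<langle>f, \<psi>\<^sub>n\<rangle> \<langle>\<psi>\<^sub>n, g\<rangle>\<close>, which is visibly Hermitian in \<open>f\<close> and \<open>g\<close> and
  for \<open>g = f\<close> is the frame sum. The lower frame bound therefore makes \<open>S\<close> coercive, and a
  coercive bounded operator is invertible (\<open>coercive_operator_invertible\<close>, the Lax--Milgram
  argument). The case of negative weights is the positive one for \<open>- m\<close>, up to an overall sign.
\<close>

section \<open>Complex inner products\<close>

lemma scaleC_zero_left: "0 *\<^sub>C x = (0::'a::complex_vector)"
  using scaleC_add_left[of 0 0 x] by simp

lemma scaleC_minus_left: "(- c) *\<^sub>C x = - (c *\<^sub>C (x::'a::complex_vector))"
  using scaleC_add_left[of "- c" c x] by (simp add: scaleC_zero_left eq_neg_iff_add_eq_0)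

lemma scaleC_zero_right: "c *\<^sub>C 0 = (0::'a::complex_vector)"
  using scaleC_add_right[of c 0 0] by simp

lemma scaleC_minus_right: "c *\<^sub>C (- x) = - (c *\<^sub>C (x::'a::complex_vector))"
  using scaleC_add_right[of c "- x" x] by (simp add: scaleC_zero_right eq_neg_iff_add_eq_0)

lemma cinner_zero_left: "cinner 0 (x::'a::complex_inner) = 0"
  using cinner_add_left[of 0 0 x] by simp

lemma cinner_minus_left: "cinner (- x) (y::'a::complex_inner) = - cinner x y"
  using cinner_add_left[of "- x" x y] by (simp add: cinner_zero_left eq_neg_iff_add_eq_0)

lemma cinner_diff_left: "cinner (x - y) (z::'a::complex_inner) = cinner x z - cinner y z"
  using cinner_add_left[of x "- y" z] by (simp add: cinner_minus_left)

lemma cinner_minus_right: "cinner x (- (y::'a::complex_inner)) = - cinner x y"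
  by (metis cinner_commute cinner_minus_left complex_cnj_minus)

lemma cinner_diff_right: "cinner x (y - (z::'a::complex_inner)) = cinner x y - cinner x z"
  by (metis cinner_commute cinner_diff_left complex_cnj_diff)

lemma cinner_scaleC_right: "cinner x (c *\<^sub>C (y::'a::complex_inner)) = cnj c * cinner x y"
  by (metis cinner_commute cinner_scaleC_left complex_cnj_mult)

lemma cinner_scaleR_left: "cinner (r *\<^sub>R x) (y::'a::complex_inner) = of_real r * cinner x y"
  by (simp add: scaleR_scaleC cinner_scaleC_left)

lemma cinner_scaleR_right: "cinner x (r *\<^sub>R (y::'a::complex_inner)) = of_real r * cinner x y"
  by (simp add: scaleR_scaleC cinner_scaleC_right)

lemma cinner_sum_left: "cinner (\<Sum>i\<in>F. f i) (y::'a::complex_inner) = (\<Sum>i\<in>F. cinner (f i) y)"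
  by (induction F rule: infinite_finite_induct) (simp_all add: cinner_zero_left cinner_add_left)

lemma cinner_self: "cinner x (x::'a::complex_inner) = of_real ((norm x)\<^sup>2)"
proof (rule complex_eqI)
  have "0 \<le> Re (cinner x x)" "Im (cinner x x) = 0"
    using cinner_ge_zero[of x] by (simp_all add: less_eq_complex_def)
  then show "Re (cinner x x) = Re (of_real ((norm x)\<^sup>2))" "Im (cinner x x) = Im (of_real ((norm x)\<^sup>2))"
    by (simp_all add: norm_eq_sqrt_cinner)
qed

lemma norm_diff_squared:
  "(norm (x - (y::'a::complex_inner)))\<^sup>2 = (norm x)\<^sup>2 + (norm y)\<^sup>2 - 2 * Re (cinner x y)"
proof -
  have "complex_of_real ((norm (x - y))\<^sup>2) =
      of_real ((norm x)\<^sup>2) + of_real ((norm y)\<^sup>2) - (cinner x y + cnj (cinner x y))"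
    unfolding cinner_self[symmetric]
    by (simp add: cinner_diff_left cinner_diff_right cinner_commute[of x y])
  then have "Re (complex_of_real ((norm (x - y))\<^sup>2)) = 
      Re (of_real ((norm x)\<^sup>2) + of_real ((norm y)\<^sup>2) - (cinner x y + cnj (cinner x y)))"
    by (rule arg_cong)
  then show ?thesis
    by simp
qed

lemma norm_scaleC: "norm (c *\<^sub>C (x::'a::complex_inner)) = cmod c * norm x"
proof (rule power2_eq_imp_eq)
  have "complex_of_real ((norm (c *\<^sub>C x))\<^sup>2) = c * cnj c * of_real ((norm x)\<^sup>2)"
    by (simp only: cinner_self[symmetric] cinner_scaleC_left cinner_scaleC_right mult_ac)
  also have "\<dots> = of_real ((cmod c * norm x)\<^sup>2)"
    by (simp add: complex_norm_square[symmetric] power_mult_distrib)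
  finally show "(norm (c *\<^sub>C x))\<^sup>2 = (cmod c * norm x)\<^sup>2"
    by (simp only: of_real_eq_iff)
qed auto

text \<open>
  Cauchy--Schwarz, from expanding \<open>\<parallel>s x - c y\<parallel>\<^sup>2 \<ge> 0\<close> with \<open>s = \<parallel>y\<parallel>\<^sup>2\<close> and \<open>c = \<langle>x, y\<rangle>\<close>. This is the
  multiple by \<open>s\<close> of the component of \<open>x\<close> orthogonal to \<open>y\<close>, and it avoids division.
\<close>

lemma cmod_cinner_le: "cmod (cinner x (y::'a::complex_inner)) \<le> norm x * norm y"
proof (cases "y = 0")
  case True
  then show ?thesis
    using cinner_commute[of x y] by (simp add: cinner_zero_left)
next
  case False
  define s c where "s = (norm y)\<^sup>2" and "c = cinner x y"
  have s: "s > 0"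
    using False by (simp add: s_def)
  have "Re (cinner (s *\<^sub>R x) (c *\<^sub>C y)) = Re (of_real s * (c * cnj c))"
    by (simp add: cinner_scaleR_left cinner_scaleC_right c_def mult_ac)
  also have "\<dots> = s * (cmod c)\<^sup>2"
    by (simp only: complex_norm_square[symmetric] Re_complex_of_real of_real_mult[symmetric])
  finally have "0 \<le> (s * norm x)\<^sup>2 + (cmod c * norm y)\<^sup>2 - 2 * (s * (cmod c)\<^sup>2)"
    using zero_le_power2[of "norm (s *\<^sub>R x - c *\<^sub>C y)"] s
    by (simp add: norm_diff_squared norm_scaleC)
  also have "\<dots> = s * (s * (norm x)\<^sup>2 - (cmod c)\<^sup>2)"
    by (simp add: s_def power2_eq_square algebra_simps)
  finally have "(cmod c)\<^sup>2 \<le> (norm x * norm y)\<^sup>2"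
    using s by (simp add: zero_le_mult_iff s_def power_mult_distrib mult.commute)
  then show ?thesis
    unfolding c_def by (rule power2_le_imp_le) simp
qed

lemma bounded_linear_cinner_left: "bounded_linear (\<lambda>x. cinner x (y::'a::complex_inner))"
  by (rule bounded_linear_intro[where K = "norm y"])
    (simp_all add: cinner_add_left cinner_scaleR_left cmod_cinner_le scaleR_conv_of_real)

lemma bounded_linear_scaleC: "bounded_linear (\<lambda>x::'a::complex_inner. c *\<^sub>C x)"
  by (rule bounded_linear_intro[where K = "cmod c"])
    (simp_all add: scaleC_add_right scaleR_scaleC scaleC_scaleC norm_scaleC mult.commute)

section \<open>Bounded operators\<close>

lemma bounded_operator_uminus: "bounded_operator T \<Longrightarrow> bounded_operator (\<lambda>f. - T f)"
  by (simp add: bounded_operator_def bounded_linear_minus scaleC_minus_right)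

lemma self_adjoint_operator_uminus:
  "self_adjoint_operator T \<Longrightarrow> self_adjoint_operator (\<lambda>f. - T f)"
  by (simp add: self_adjoint_operator_def bounded_operator_uminus cinner_minus_left cinner_minus_right)

lemma invertible_operator_uminus:
  assumes "invertible_operator T"
  shows "invertible_operator (\<lambda>f. - T f)"
proof -
  obtain S where T: "bounded_operator T" and S: "bounded_operator S"
    and inv: "S \<circ> T = id" "T \<circ> S = id"
    using assms by (auto simp: invertible_operator_def)
  have "S (- x) = - S x" "T (- x) = - T x" for x
    using S T by (auto simp: bounded_operator_def dest: bounded_linear.linear linear_neg)
  then have "(\<lambda>f. - S f) \<circ> (\<lambda>f. - T f) = id" "(\<lambda>f. - T f) \<circ> (\<lambda>f. - S f) = id"
    using inv by (auto simp: fun_eq_iff)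
  then show ?thesis
    using S T bounded_operator_uminus unfolding invertible_operator_def by blast
qed

text \<open>
  The Lax--Milgram argument. To solve \<open>T x = y\<close>, iterate \<open>x \<mapsto> x - t (T x - y)\<close>: coercivity and
  the bound \<open>K\<close> on \<open>T\<close> give \<open>\<parallel>z - t T z\<parallel>\<^sup>2 \<le> (1 - 2 t A + t\<^sup>2 K\<^sup>2) \<parallel>z\<parallel>\<^sup>2\<close>, and the choice \<open>t = A / K\<^sup>2\<close>
  makes the factor \<open>1 - A\<^sup>2 / K\<^sup>2 < 1\<close>, so Banach's fixed point theorem applies. Coercivity also
  bounds \<open>T\<close> below by \<open>A\<close>, so the inverse is bounded.
\<close>

lemma coercive_operator_invertible:
  fixes T :: "'a::complex_hilbert_space \<Rightarrow> 'a"
  assumes T: "bounded_operator T" and A: "0 < A"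
    and coercive: "\<And>f. A * (norm f)\<^sup>2 \<le> Re (cinner (T f) f)"
  shows "invertible_operator T"
proof -
  have lin: "bounded_linear T" and T_scaleC: "\<And>c f. T (c *\<^sub>C f) = c *\<^sub>C T f"
    using T by (auto simp: bounded_operator_def)
  interpret bounded_linear T
    by (rule lin)
  obtain K0 where K0: "\<And>f. norm (T f) \<le> norm f * K0"
    using bounded by blast
  \<comment> \<open>On a nontrivial space coercivity forces \<open>A \<le> K0\<close>; the maximum also covers the trivial one.\<close>
  define K where "K = max A K0"
  have K: "A \<le> K" "0 < K" "\<And>f. norm (T f) \<le> K * norm f"
    using A order_trans[OF K0 mult_left_mono[OF max.cobounded2[of K0 A] norm_ge_zero]]
    by (auto simp: K_def mult.commute)
  have below: "A * norm f \<le> norm (T f)" for f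
  proof (cases "f = 0")
    case False
    have "A * (norm f)\<^sup>2 \<le> norm (T f) * norm f"
      using coercive[of f] complex_Re_le_cmod[of "cinner (T f) f"] cmod_cinner_le[of "T f" f]
      by linarith
    then show ?thesis
      using False by (simp add: power2_eq_square)
  qed simp
  define t q where "t = A / K\<^sup>2" and "q = sqrt (1 - A\<^sup>2 / K\<^sup>2)"
  have AK: "0 < A\<^sup>2 / K\<^sup>2" "A\<^sup>2 / K\<^sup>2 \<le> 1"
    using A K(1,2) by (auto simp: power_mono)
  then have q: "0 \<le> q" "q < 1"
    by (simp_all add: q_def)
  have t: "0 < t"
    using A K by (simp add: t_def)
  have contr: "norm (z - t *\<^sub>R T z) \<le> q * norm z" for z
  proof (rule power2_le_imp_le)
    have "(norm (T z))\<^sup>2 \<le> (K * norm z)\<^sup>2"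
      by (rule power_mono[OF K(3)]) simp
    then have "t\<^sup>2 * (norm (T z))\<^sup>2 \<le> t\<^sup>2 * (K * norm z)\<^sup>2"
      by (rule mult_left_mono) simp
    moreover have "t * (A * (norm z)\<^sup>2) \<le> t * Re (cinner z (T z))"
      using coercive[of z] t cinner_commute[of z "T z"] by (simp add: mult_left_mono)
    moreover have "(norm (z - t *\<^sub>R T z))\<^sup>2
        = (norm z)\<^sup>2 + t\<^sup>2 * (norm (T z))\<^sup>2 - 2 * (t * Re (cinner z (T z)))"
      by (simp add: norm_diff_squared cinner_scaleR_right power_mult_distrib)
    ultimately have "(norm (z - t *\<^sub>R T z))\<^sup>2
        \<le> (norm z)\<^sup>2 + t\<^sup>2 * (K * norm z)\<^sup>2 - 2 * (t * (A * (norm z)\<^sup>2))"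
      by linarith
    also have "\<dots> = (1 - A\<^sup>2 / K\<^sup>2) * (norm z)\<^sup>2"
      using K(2) by (simp add: t_def field_simps power2_eq_square)
    also have "\<dots> = (q * norm z)\<^sup>2"
      using AK by (simp add: q_def power_mult_distrib)
    finally show "(norm (z - t *\<^sub>R T z))\<^sup>2 \<le> (q * norm z)\<^sup>2" .
  qed (use q in simp)
  have "\<exists>x. T x = y" for y
  proof -
    define \<Phi> where "\<Phi> = (\<lambda>x. x - t *\<^sub>R (T x - y))"
    have "dist (\<Phi> x) (\<Phi> x') \<le> q * dist x x'" for x x'
    proof -
      have "\<Phi> x - \<Phi> x' = (x - x') - t *\<^sub>R T (x - x')"
        by (simp add: \<Phi>_def diff algebra_simps)
      then show ?thesis
        using contr[of "x - x'"] by (simp add: dist_norm)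
    qed
    then obtain x where "\<Phi> x = x"
      using banach_fix_type[of q \<Phi>] q by blast
    then show ?thesis
      using t by (auto simp: \<Phi>_def)
  qed
  then obtain S where TS: "\<And>y. T (S y) = y"
    by metis
  have inj: "x = x'" if "T x = T x'" for x x'
  proof -
    have "A * norm (x - x') \<le> 0"
      using below[of "x - x'"] that by (simp add: diff)
    then show ?thesis
      using A by (simp add: mult_le_0_iff)
  qed
  have "bounded_operator S"
    unfolding bounded_operator_def
  proof (intro conjI allI)
    show "S (c *\<^sub>C f) = c *\<^sub>C S f" for c f
      by (rule inj) (simp add: TS T_scaleC)
    show "bounded_linear S"
    proof (rule bounded_linear_intro[where K = "1 / A"])
      show "S (x + y) = S x + S y" for x y
        by (rule inj) (simp add: TS add)
      show "S (r *\<^sub>R x) = r *\<^sub>R S x" for r x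
        by (rule inj) (simp add: TS scaleR)
      show "norm (S x) \<le> norm x * (1 / A)" for x
        using below[of "S x"] A by (simp add: TS field_simps)
    qed
  qed
  moreover have "S \<circ> T = id" "T \<circ> S = id"
    using TS inj by (auto simp: fun_eq_iff)
  ultimately show ?thesis
    using T by (auto simp: invertible_operator_def)
qed

section \<open>Frames and their frame operators\<close>

text \<open>
  Outside a finite \<open>F\<^sub>0\<close> that nearly exhausts \<open>\<Sum> g\<close>, finite sums of \<open>f\<close> are small, so the finite
  partial sums of \<open>f\<close> form a Cauchy net. The square lets the criterion reach series that need not
  converge absolutely, such as \<open>\<Sum> c\<^sub>n \<phi>\<^sub>n\<close> with merely square summable coefficients.
\<close>

lemma summable_on_square_dominated:
  fixes f :: "'i \<Rightarrow> 'a::{real_normed_vector, complete_space}" and g :: "'i \<Rightarrow> real"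
  assumes g: "g summable_on \<Gamma>" "\<And>n. n \<in> \<Gamma> \<Longrightarrow> 0 \<le> g n" and C: "0 < C"
    and dominated: "\<And>F. finite F \<Longrightarrow> F \<subseteq> \<Gamma> \<Longrightarrow> (norm (sum f F))\<^sup>2 \<le> C * sum g F"
  shows "f summable_on \<Gamma>"
proof -
  have "\<exists>P. eventually P (finite_subsets_at_top \<Gamma>) \<and>
      (\<forall>F1 F2. P F1 \<and> P F2 \<longrightarrow> dist (sum f F1) (sum f F2) < e)" if e: "0 < e" for e
  proof -
    define \<delta> where "\<delta> = (e / 2)\<^sup>2 / C"
    have "\<delta> > 0"
      using e C by (simp add: \<delta>_def)
    then have "\<forall>\<^sub>F F in finite_subsets_at_top \<Gamma>. dist (sum g F) (infsum g \<Gamma>) < \<delta>"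
      using infsum_tendsto[OF g(1)] by (rule tendstoD[rotated])
    then obtain F0 where F0: "finite F0" "F0 \<subseteq> \<Gamma>" "dist (sum g F0) (infsum g \<Gamma>) < \<delta>"
      by (auto simp: eventually_finite_subsets_at_top)
    have close: "dist (sum f F) (sum f F0) < e / 2" if F: "finite F" "F0 \<subseteq> F" "F \<subseteq> \<Gamma>" for F
    proof -
      have "sum g F \<le> infsum g \<Gamma>"
        using g F by (intro finite_sum_le_infsum) auto
      then have "sum g (F - F0) < \<delta>"
        using F F0(3) by (simp add: sum_diff dist_real_def)
      then have "C * sum g (F - F0) < (e / 2)\<^sup>2"
        using C by (simp add: \<delta>_def field_simps)
      moreover have "(norm (sum f (F - F0)))\<^sup>2 \<le> C * sum g (F - F0)"
        using F by (intro dominated) auto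
      ultimately have "(norm (sum f (F - F0)))\<^sup>2 < (e / 2)\<^sup>2"
        by linarith
      then have "norm (sum f (F - F0)) < e / 2"
        by (rule power2_less_imp_less) (use e in simp)
      then show ?thesis
        using F by (simp add: dist_norm sum_diff)
    qed
    have "eventually (\<lambda>F. finite F \<and> F0 \<subseteq> F \<and> F \<subseteq> \<Gamma>) (finite_subsets_at_top \<Gamma>)"
      using F0 by (auto simp: eventually_finite_subsets_at_top)
    moreover have "dist (sum f F1) (sum f F2) < e"
      if "finite F1 \<and> F0 \<subseteq> F1 \<and> F1 \<subseteq> \<Gamma>" "finite F2 \<and> F0 \<subseteq> F2 \<and> F2 \<subseteq> \<Gamma>" for F1 F2
      by (rule dist_triangle_half_l[of _ "sum f F0"]; rule close) (use that in simp_all)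
    ultimately show ?thesis
      by (intro exI[of _ "\<lambda>F. finite F \<and> F0 \<subseteq> F \<and> F \<subseteq> \<Gamma>"]) simp
  qed
  then have "cauchy_filter (filtermap (sum f) (finite_subsets_at_top \<Gamma>))"
    by (simp add: cauchy_filter_metric_filtermap)
  moreover have "complete (UNIV :: 'a set)"
    by (rule complete_UNIV)
  ultimately obtain L where "(sum f \<longlongrightarrow> L) (finite_subsets_at_top \<Gamma>)"
    using complete_uniform[where S = "UNIV :: 'a set"] by (force simp add: filterlim_def)
  then show ?thesis
    by (auto simp: summable_on_def has_sum_def)
qed

text \<open>
  The upper bound is taken to be positive, which every frame permits; this matters only on the
  trivial space, where \<open>is_frame\<close> accepts any number as upper bound.
\<close>

locale frame_with_bounds =
  fixes \<Gamma> :: "'i set" and \<phi> :: "'i \<Rightarrow> 'a::complex_hilbert_space" and A B :: real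
  assumes A_pos: "0 < A" and B_pos: "0 < B"
    and summable: "(\<lambda>n. (cmod (cinner f (\<phi> n)))\<^sup>2) summable_on \<Gamma>"
    and lower: "A * (norm f)\<^sup>2 \<le> (\<Sum>\<^sub>\<infinity>n\<in>\<Gamma>. (cmod (cinner f (\<phi> n)))\<^sup>2)"
    and upper: "(\<Sum>\<^sub>\<infinity>n\<in>\<Gamma>. (cmod (cinner f (\<phi> n)))\<^sup>2) \<le> B * (norm f)\<^sup>2"
begin

lemma analysis_bound:
  assumes "finite F" "F \<subseteq> \<Gamma>"
  shows "(\<Sum>n\<in>F. (cmod (cinner f (\<phi> n)))\<^sup>2) \<le> B * (norm f)\<^sup>2"
  by (rule order_trans[OF finite_sum_le_infsum[OF summable assms] upper]) simp

text \<open>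
  Duality between analysis and synthesis: for \<open>x = \<Sum> c\<^sub>n \<phi>\<^sub>n\<close>, Cauchy--Schwarz for finite sums bounds
  \<open>\<parallel>x\<parallel>\<^sup>2 = \<Sum> c\<^sub>n \<langle>\<phi>\<^sub>n, x\<rangle>\<close> by the \<open>\<ell>\<^sup>2\<close> norm of \<open>c\<close> times that of the analysis coefficients of \<open>x\<close> itself,
  and one factor \<open>\<parallel>x\<parallel>\<close> cancels.
\<close>

lemma synthesis_bound:
  assumes F: "finite F" "F \<subseteq> \<Gamma>"
  shows "(norm (\<Sum>n\<in>F. c n *\<^sub>C \<phi> n))\<^sup>2 \<le> B * (\<Sum>n\<in>F. (cmod (c n))\<^sup>2)"
proof -
  define x where "x = (\<Sum>n\<in>F. c n *\<^sub>C \<phi> n)"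
  have "(norm x)\<^sup>2 = cmod (cinner x x)"
    by (simp add: cinner_self norm_power)
  also have "cinner x x = (\<Sum>n\<in>F. c n * cinner (\<phi> n) x)"
    by (subst (1) x_def) (simp add: cinner_sum_left cinner_scaleC_left)
  also have "cmod \<dots> \<le> (\<Sum>n\<in>F. cmod (c n) * cmod (cinner x (\<phi> n)))"
    by (rule sum_norm_le) (simp add: norm_mult cinner_commute[of x])
  finally have "((norm x)\<^sup>2)\<^sup>2 \<le> (\<Sum>n\<in>F. cmod (c n) * cmod (cinner x (\<phi> n)))\<^sup>2"
    by (rule power_mono) simp
  also have "\<dots> \<le> (\<Sum>n\<in>F. (cmod (c n))\<^sup>2) * (\<Sum>n\<in>F. (cmod (cinner x (\<phi> n)))\<^sup>2)"
    by (rule Cauchy_Schwarz_ineq_sum)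
  also have "\<dots> \<le> (\<Sum>n\<in>F. (cmod (c n))\<^sup>2) * (B * (norm x)\<^sup>2)"
    by (intro mult_left_mono analysis_bound F sum_nonneg) auto
  finally have "(norm x)\<^sup>2 * (norm x)\<^sup>2 \<le> (B * (\<Sum>n\<in>F. (cmod (c n))\<^sup>2)) * (norm x)\<^sup>2"
    by (simp add: power2_eq_square[of "(norm x)\<^sup>2"] mult_ac)
  moreover have "0 \<le> B * (\<Sum>n\<in>F. (cmod (c n))\<^sup>2)"
    using B_pos by (intro mult_nonneg_nonneg sum_nonneg) auto
  ultimately have "(norm x)\<^sup>2 \<le> B * (\<Sum>n\<in>F. (cmod (c n))\<^sup>2)"
  proof (cases "x = 0")
    case False
    then have "0 < (norm x)\<^sup>2"
      by simp
    with \<open>(norm x)\<^sup>2 * (norm x)\<^sup>2 \<le> (B * (\<Sum>n\<in>F. (cmod (c n))\<^sup>2)) * (norm x)\<^sup>2\<close> show ?thesis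
      by (rule mult_right_le_imp_le)
  qed simp
  then show ?thesis
    by (simp only: x_def)
qed

lemma frame_operator_has_sum:
  "((\<lambda>n. cinner f (\<phi> n) *\<^sub>C \<phi> n) has_sum frame_operator \<Gamma> \<phi> f) \<Gamma>"
proof -
  have "(\<lambda>n. cinner f (\<phi> n) *\<^sub>C \<phi> n) summable_on \<Gamma>"
    by (rule summable_on_square_dominated[OF summable _ B_pos synthesis_bound]) auto
  then show ?thesis
    unfolding frame_operator_def by (rule has_sum_infsum)
qed

lemma norm_frame_operator_le: "norm (frame_operator \<Gamma> \<phi> f) \<le> B * norm f"
proof -
  have "norm (\<Sum>n\<in>F. cinner f (\<phi> n) *\<^sub>C \<phi> n) \<le> B * norm f" if F: "finite F" "F \<subseteq> \<Gamma>" for F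
  proof (rule power2_le_imp_le)
    have "(norm (\<Sum>n\<in>F. cinner f (\<phi> n) *\<^sub>C \<phi> n))\<^sup>2 \<le> B * (\<Sum>n\<in>F. (cmod (cinner f (\<phi> n)))\<^sup>2)"
      by (rule synthesis_bound[OF F])
    also have "\<dots> \<le> B * (B * (norm f)\<^sup>2)"
      using B_pos analysis_bound[OF F] by (simp add: mult_left_mono)
    finally show "(norm (\<Sum>n\<in>F. cinner f (\<phi> n) *\<^sub>C \<phi> n))\<^sup>2 \<le> (B * norm f)\<^sup>2"
      by (simp add: power2_eq_square mult_ac)
  qed (use B_pos in simp)
  then have "\<forall>\<^sub>F F in finite_subsets_at_top \<Gamma>. norm (\<Sum>n\<in>F. cinner f (\<phi> n) *\<^sub>C \<phi> n) \<le> B * norm f"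
    by (intro eventually_finite_subsets_at_top_weakI)
  moreover have "finite_subsets_at_top \<Gamma> \<noteq> bot"
    by simp
  ultimately show ?thesis
    using frame_operator_has_sum[of f] unfolding has_sum_def by (intro Lim_norm_ubound)
qed

lemma bounded_operator_frame_operator: "bounded_operator (frame_operator \<Gamma> \<phi>)"
proof -
  have scale: "frame_operator \<Gamma> \<phi> (c *\<^sub>C f) = c *\<^sub>C frame_operator \<Gamma> \<phi> f" for c f
  proof (rule has_sum_unique[OF frame_operator_has_sum])
    show "((\<lambda>n. cinner (c *\<^sub>C f) (\<phi> n) *\<^sub>C \<phi> n) has_sum c *\<^sub>C frame_operator \<Gamma> \<phi> f) \<Gamma>"
      using has_sum_bounded_linear[OF bounded_linear_scaleC[of c] frame_operator_has_sum[of f]]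
      by (simp add: cinner_scaleC_left scaleC_scaleC)
  qed
  have "frame_operator \<Gamma> \<phi> (f + g) = frame_operator \<Gamma> \<phi> f + frame_operator \<Gamma> \<phi> g" for f g
  proof (rule has_sum_unique[OF frame_operator_has_sum])
    show "((\<lambda>n. cinner (f + g) (\<phi> n) *\<^sub>C \<phi> n)
        has_sum (frame_operator \<Gamma> \<phi> f + frame_operator \<Gamma> \<phi> g)) \<Gamma>"
      using has_sum_add[OF frame_operator_has_sum[of f] frame_operator_has_sum[of g]]
      by (simp add: cinner_add_left scaleC_add_left)
  qed
  then have "bounded_linear (frame_operator \<Gamma> \<phi>)"
    by (rule bounded_linear_intro[where K = B])
      (simp_all only: scale scaleR_scaleC norm_frame_operator_le mult.commute[of _ B])
  then show ?thesis
    by (simp add: bounded_operator_def scale)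
qed

lemma cinner_frame_operator_has_sum:
  "((\<lambda>n. cinner f (\<phi> n) * cinner (\<phi> n) g) has_sum cinner (frame_operator \<Gamma> \<phi> f) g) \<Gamma>"
  using has_sum_bounded_linear[OF bounded_linear_cinner_left[of g] frame_operator_has_sum[of f]]
  by (simp add: cinner_scaleC_left)

lemma cinner_frame_operator_self:
  "cinner (frame_operator \<Gamma> \<phi> f) f = of_real (\<Sum>\<^sub>\<infinity>n\<in>\<Gamma>. (cmod (cinner f (\<phi> n)))\<^sup>2)"
proof -
  have "cinner f (\<phi> n) * cinner (\<phi> n) f = of_real ((cmod (cinner f (\<phi> n)))\<^sup>2)" for n
    unfolding complex_norm_square by (simp add: cinner_commute[of "\<phi> n" f])
  then have "((\<lambda>n. cinner f (\<phi> n) * cinner (\<phi> n) f)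
      has_sum of_real (\<Sum>\<^sub>\<infinity>n\<in>\<Gamma>. (cmod (cinner f (\<phi> n)))\<^sup>2)) \<Gamma>"
    using has_sum_of_real[OF has_sum_infsum[OF summable[of f]]] by (simp only:)
  then show ?thesis
    by (rule has_sum_unique[OF cinner_frame_operator_has_sum])
qed

lemma self_adjoint_frame_operator: "self_adjoint_operator (frame_operator \<Gamma> \<phi>)"
proof -
  have "cinner (frame_operator \<Gamma> \<phi> f) g = cnj (cinner (frame_operator \<Gamma> \<phi> g) f)" for f g
  proof (rule has_sum_unique[OF cinner_frame_operator_has_sum])
    have "((\<lambda>n. cnj (cinner g (\<phi> n) * cinner (\<phi> n) f))
        has_sum cnj (cinner (frame_operator \<Gamma> \<phi> g) f)) \<Gamma>"
      using cinner_frame_operator_has_sum by (simp only: has_sum_cnj_iff)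
    then show "((\<lambda>n. cinner f (\<phi> n) * cinner (\<phi> n) g)
        has_sum cnj (cinner (frame_operator \<Gamma> \<phi> g) f)) \<Gamma>"
      by (simp add: cinner_commute[symmetric] mult.commute)
  qed
  then show ?thesis
    by (simp add: self_adjoint_operator_def bounded_operator_frame_operator cinner_commute[symmetric])
qed

lemma positive_frame_operator: "positive_operator (frame_operator \<Gamma> \<phi>)"
proof -
  have "0 < (\<Sum>\<^sub>\<infinity>n\<in>\<Gamma>. (cmod (cinner f (\<phi> n)))\<^sup>2)" if "f \<noteq> 0" for f
    using lower[of f] A_pos that by (intro less_le_trans[OF _ lower]) simp
  then show ?thesis
    by (simp add: positive_operator_def bounded_operator_frame_operator cinner_frame_operator_self
        less_complex_def)
qed

lemma invertible_frame_operator: "invertible_operator (frame_operator \<Gamma> \<phi>)"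
  by (rule coercive_operator_invertible[OF bounded_operator_frame_operator A_pos])
    (simp add: cinner_frame_operator_self lower)

end

lemma is_frame_imp_frame_with_bounds:
  assumes "is_frame \<Gamma> (\<phi> :: 'i \<Rightarrow> 'a::complex_hilbert_space)"
  obtains A B where "frame_with_bounds \<Gamma> \<phi> A B"
proof -
  obtain A B where 0: "0 < A"
    and fr: "\<And>f. (\<lambda>n. (cmod (cinner f (\<phi> n)))\<^sup>2) summable_on \<Gamma>"
      "\<And>f. A * (norm f)\<^sup>2 \<le> (\<Sum>\<^sub>\<infinity>n\<in>\<Gamma>. (cmod (cinner f (\<phi> n)))\<^sup>2)"
      "\<And>f. (\<Sum>\<^sub>\<infinity>n\<in>\<Gamma>. (cmod (cinner f (\<phi> n)))\<^sup>2) \<le> B * (norm f)\<^sup>2"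
    using assms unfolding is_frame_def by blast
  have "(\<Sum>\<^sub>\<infinity>n\<in>\<Gamma>. (cmod (cinner f (\<phi> n)))\<^sup>2) \<le> max B 1 * (norm f)\<^sup>2" for f
    using fr(3)[of f] mult_right_mono[OF max.cobounded1[of B 1] zero_le_power2[of "norm f"]]
    by linarith
  then have "frame_with_bounds \<Gamma> \<phi> A (max B 1)"
    using 0 fr by unfold_locales auto
  then show ?thesis
    by (rule that)
qed

section \<open>Multipliers as frame operators\<close>

lemma csqrt_pos_eq_of_real:
  assumes "0 < (z::complex)"
  shows "csqrt z = of_real (sqrt (cmod z))"
proof -
  have z: "z = of_real (cmod z)"
    using assms by (simp add: less_complex_def complex_eq_iff cmod_def)
  show ?thesis
    by (subst z) (simp add: csqrt_of_real_nonneg)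
qed

text \<open>
  The second slot of the inner product is conjugate linear, so the two square roots multiply to
  \<open>\<bar>z\<bar>\<close>; positivity is what makes this equal to \<open>z\<close>.
\<close>

lemma weighted_frame_term:
  assumes "0 < (z::complex)"
  shows "(z * cinner f x) *\<^sub>C x = cinner f (csqrt z *\<^sub>C x) *\<^sub>C csqrt z *\<^sub>C (x::'a::complex_inner)"
proof -
  have "cnj (csqrt z) = csqrt z"
    by (simp add: csqrt_pos_eq_of_real[OF assms])
  then have "cinner f (csqrt z *\<^sub>C x) *\<^sub>C csqrt z *\<^sub>C x = ((csqrt z)\<^sup>2 * cinner f x) *\<^sub>C x"
    by (simp only: cinner_scaleC_right scaleC_scaleC power2_eq_square mult_ac)
  then show ?thesis
    by simp
qed

lemma multiplier_eq_frame_operator: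
  assumes "\<forall>n\<in>\<Gamma>. 0 < m n"
  shows "multiplier \<Gamma> m \<psi> = frame_operator \<Gamma> (\<lambda>n. csqrt (m n) *\<^sub>C \<psi> n)"
  unfolding multiplier_def frame_operator_def fun_eq_iff
  using assms by (auto intro!: infsum_cong simp: weighted_frame_term)

text \<open>
  Only the modulus of the weight enters, as \<open>\<bar>\<langle>f, \<surd>m\<^sub>n \<psi>\<^sub>n\<rangle>\<bar>\<^sup>2 = \<bar>m\<^sub>n\<bar> \<bar>\<langle>f, \<psi>\<^sub>n\<rangle>\<bar>\<^sup>2\<close> for every complex \<open>m\<^sub>n\<close>,
  and the frame bounds get multiplied by the bounds for \<open>\<bar>m\<^sub>n\<bar>\<close>.
\<close>

lemma is_frame_csqrt_weights:
  fixes \<psi> :: "'i \<Rightarrow> 'a::complex_hilbert_space"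
  assumes "is_frame \<Gamma> \<psi>" and "semi_normalized \<Gamma> m"
  shows "is_frame \<Gamma> (\<lambda>n. csqrt (m n) *\<^sub>C \<psi> n)"
proof -
  obtain A B where "frame_with_bounds \<Gamma> \<psi> A B"
    using assms(1) by (rule is_frame_imp_frame_with_bounds)
  then interpret frame_with_bounds \<Gamma> \<psi> A B .
  obtain a b where ab: "0 < a" "a \<le> b" "\<And>n. n \<in> \<Gamma> \<Longrightarrow> a \<le> cmod (m n) \<and> cmod (m n) \<le> b"
    using assms(2) unfolding semi_normalized_def by blast
  define s where "s f n = (cmod (cinner f (\<psi> n)))\<^sup>2" for f n
  have weighted: "(cmod (cinner f (csqrt (m n) *\<^sub>C \<psi> n)))\<^sup>2 = cmod (m n) * s f n" for f n
    by (simp add: s_def cinner_scaleC_right norm_mult power_mult_distrib norm_power[symmetric])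
  have s: "s f summable_on \<Gamma>" "A * (norm f)\<^sup>2 \<le> infsum (s f) \<Gamma>" "infsum (s f) \<Gamma> \<le> B * (norm f)\<^sup>2" for f
    using summable[of f] lower[of f] upper[of f] by (simp_all add: s_def[abs_def])
  have s_nonneg: "0 \<le> s f n" for f n
    by (simp add: s_def)
  have ws: "(\<lambda>n. cmod (m n) * s f n) summable_on \<Gamma>" for f
    by (rule summable_on_comparison_test[OF summable_on_cmult_right[OF s(1), of b]])
      (use ab(3) s_nonneg in \<open>auto intro!: mult_right_mono\<close>)
  have "a * A * (norm f)\<^sup>2 \<le> (\<Sum>\<^sub>\<infinity>n\<in>\<Gamma>. cmod (m n) * s f n)" for f
  proof -
    have "a * (A * (norm f)\<^sup>2) \<le> a * infsum (s f) \<Gamma>"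
      using ab(1) s(2) by (intro mult_left_mono) auto
    also have "\<dots> = (\<Sum>\<^sub>\<infinity>n\<in>\<Gamma>. a * s f n)"
      by (rule infsum_cmult_right'[symmetric])
    also have "\<dots> \<le> (\<Sum>\<^sub>\<infinity>n\<in>\<Gamma>. cmod (m n) * s f n)"
      using ab(3) s_nonneg
      by (intro infsum_mono ws summable_on_cmult_right s(1)) (auto intro!: mult_right_mono)
    finally show ?thesis
      by (simp add: mult.assoc)
  qed
  moreover have "(\<Sum>\<^sub>\<infinity>n\<in>\<Gamma>. cmod (m n) * s f n) \<le> b * B * (norm f)\<^sup>2" for f
  proof -
    have "(\<Sum>\<^sub>\<infinity>n\<in>\<Gamma>. cmod (m n) * s f n) \<le> (\<Sum>\<^sub>\<infinity>n\<in>\<Gamma>. b * s f n)"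
      using ab(3) s_nonneg
      by (intro infsum_mono ws summable_on_cmult_right s(1)) (auto intro!: mult_right_mono)
    also have "\<dots> = b * infsum (s f) \<Gamma>"
      by (rule infsum_cmult_right')
    also have "\<dots> \<le> b * (B * (norm f)\<^sup>2)"
      using ab(1,2) s(3) by (intro mult_left_mono) auto
    finally show ?thesis
      by (simp add: mult.assoc)
  qed
  ultimately show ?thesis
    unfolding is_frame_def weighted
    using ab(1) A_pos ws by (intro exI[of _ "a * A"] exI[of _ "b * B"]) simp
qed

lemma positive_multiplier:
  fixes \<psi> :: "'i \<Rightarrow> 'a::complex_hilbert_space"
  assumes "is_frame \<Gamma> \<psi>" and "semi_normalized \<Gamma> m" and pos: "\<forall>n\<in>\<Gamma>. 0 < m n"
  shows "(\<lambda>n. (m n * cinner f (\<psi> n)) *\<^sub>C \<psi> n) summable_on \<Gamma>"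
    and "positive_operator (multiplier \<Gamma> m \<psi>)"
    and "self_adjoint_operator (multiplier \<Gamma> m \<psi>)"
    and "invertible_operator (multiplier \<Gamma> m \<psi>)"
proof -
  let ?\<phi> = "\<lambda>n. csqrt (m n) *\<^sub>C \<psi> n"
  obtain A B where "frame_with_bounds \<Gamma> ?\<phi> A B"
    using is_frame_csqrt_weights[OF assms(1,2)] by (rule is_frame_imp_frame_with_bounds)
  then interpret frame_with_bounds \<Gamma> ?\<phi> A B .
  have "(\<lambda>n. cinner f (?\<phi> n) *\<^sub>C ?\<phi> n) summable_on \<Gamma>"
    using frame_operator_has_sum by (rule has_sum_imp_summable)
  then show "(\<lambda>n. (m n * cinner f (\<psi> n)) *\<^sub>C \<psi> n) summable_on \<Gamma>"
    using pos by (subst summable_on_cong[OF weighted_frame_term]) auto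
  show "positive_operator (multiplier \<Gamma> m \<psi>)" "self_adjoint_operator (multiplier \<Gamma> m \<psi>)"
    "invertible_operator (multiplier \<Gamma> m \<psi>)"
    unfolding multiplier_eq_frame_operator[OF pos]
    by (rule positive_frame_operator self_adjoint_frame_operator invertible_frame_operator)+
qed

lemma multiplier_uminus: "multiplier \<Gamma> (\<lambda>n. - m n) \<psi> f = - multiplier \<Gamma> m \<psi> f"
  by (simp add: multiplier_def scaleC_minus_left infsum_uminus)

theorem lemma4p4:
  fixes \<Gamma> :: "'i set"
    and \<psi> :: "'i \<Rightarrow> 'a::complex_hilbert_space"
    and m :: "'i \<Rightarrow> complex"
  assumes "separable_space (euclidean :: 'a topology)"
    and "countable \<Gamma>"
    and "is_frame \<Gamma> \<psi>"
    and "semi_normalized \<Gamma> m"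
  shows "((\<forall>n\<in>\<Gamma>. 0 < m n) \<longrightarrow>
      (\<forall>f. (\<lambda>n. (m n * cinner f (\<psi> n)) *\<^sub>C \<psi> n) summable_on \<Gamma>) \<and>
      is_frame \<Gamma> (\<lambda>n. csqrt (m n) *\<^sub>C \<psi> n) \<and>
      multiplier \<Gamma> m \<psi> = frame_operator \<Gamma> (\<lambda>n. csqrt (m n) *\<^sub>C \<psi> n) \<and>
      positive_operator (multiplier \<Gamma> m \<psi>) \<and>
      self_adjoint_operator (multiplier \<Gamma> m \<psi>) \<and>
      invertible_operator (multiplier \<Gamma> m \<psi>)) \<and>
    ((\<forall>n\<in>\<Gamma>. m n < 0) \<longrightarrow>
      (\<forall>f. (\<lambda>n. (m n * cinner f (\<psi> n)) *\<^sub>C \<psi> n) summable_on \<Gamma>) \<and>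
      negative_operator (multiplier \<Gamma> m \<psi>) \<and>
      self_adjoint_operator (multiplier \<Gamma> m \<psi>) \<and>
      invertible_operator (multiplier \<Gamma> m \<psi>))"
proof (intro conjI impI allI)
  assume pos: "\<forall>n\<in>\<Gamma>. 0 < m n"
  note multiplier = positive_multiplier[OF assms(3,4) pos]
  show "(\<lambda>n. (m n * cinner f (\<psi> n)) *\<^sub>C \<psi> n) summable_on \<Gamma>" for f
    by (rule multiplier)
  show "is_frame \<Gamma> (\<lambda>n. csqrt (m n) *\<^sub>C \<psi> n)"
    using assms(3,4) by (rule is_frame_csqrt_weights)
  show "multiplier \<Gamma> m \<psi> = frame_operator \<Gamma> (\<lambda>n. csqrt (m n) *\<^sub>C \<psi> n)"
    using pos by (rule multiplier_eq_frame_operator)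
  show "positive_operator (multiplier \<Gamma> m \<psi>)" "self_adjoint_operator (multiplier \<Gamma> m \<psi>)"
    "invertible_operator (multiplier \<Gamma> m \<psi>)"
    by (rule multiplier)+
next
  assume neg: "\<forall>n\<in>\<Gamma>. m n < 0"
  have pos: "\<forall>n\<in>\<Gamma>. 0 < - m n"
    using neg by (simp add: less_complex_def)
  have "semi_normalized \<Gamma> (\<lambda>n. - m n)"
    using assms(4) by (simp add: semi_normalized_def)
  note multiplier = positive_multiplier[OF assms(3) this pos]
  have eq: "multiplier \<Gamma> m \<psi> = (\<lambda>f. - multiplier \<Gamma> (\<lambda>n. - m n) \<psi> f)"
    by (simp add: fun_eq_iff multiplier_uminus)
  show "(\<lambda>n. (m n * cinner f (\<psi> n)) *\<^sub>C \<psi> n) summable_on \<Gamma>" for f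
    using multiplier(1)[of f] by (simp add: scaleC_minus_left summable_on_uminus)
  show "negative_operator (multiplier \<Gamma> m \<psi>)"
    unfolding negative_operator_def eq using multiplier(2) by simp
  show "self_adjoint_operator (multiplier \<Gamma> m \<psi>)"
    unfolding eq using multiplier(3) by (rule self_adjoint_operator_uminus)
  show "invertible_operator (multiplier \<Gamma> m \<psi>)"
    unfolding eq using multiplier(4) by (rule invertible_operator_uminus)
qed

end
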